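(* Let $\psi$ be a bicomplex function that is holomorphic in a domain $G\subseteq\mathrm{B}$, and let $p_0,p\in G$. Then for every integer $n\ge 1$, $$\psi(p)=\sum_{k=0}^{n-1}\frac{\psi^{(k)}(p_0)}{k!}\odot(p-p_0)^k+R_n(p,p_0),\qquad R_n(p,p_0)=\frac{1}{(n-1)!}\int_{p_0}^{p}\psi^{(n)}(q)\odot(p-q)^{n-1}\odot dq,$$ where the integral may be taken along any curve in $G$ starting at $p_0$ and ending at $p$. Moreover, if the ball $\{q\in\mathrm{B}:\|q-p_0\|\le\|p-p_0\|\}$ lies in $G$, then $\|R_n(p,p_0)\|\to 0$ as $n\to\infty$, so that the infinite Taylor series converges: $\psi(p)=\sum_{k=0}^{\infty}\frac{\psi^{(k)}(p_0)}{k!}\odot(p-p_0)^k$.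
   Context: $\mathrm{B}=\mathbb{C}^2$ is the space of bicomplex numbers $p=(a,b)$, $a,b\in\mathbb{C}$, with componentwise addition and the commutative multiplication $(a,b)\odot(c,d)=(ac-bd,\ bc+ad)$; real numbers $\lambda$ are identified with $(\lambda,0)$, and $p^0=1$, $p^k=p\odot p^{k-1}$. The norm is $\|(a,b)\|=\sqrt{|a|^2+|b|^2}$. A bicomplex number $(a,b)$ is singular if $a^2+b^2=0$, and nonsingular otherwise; a nonsingular $(a,b)$ has the inverse $\left(\frac{a}{a^2+b^2},\frac{-b}{a^2+b^2}\right)$, and $r/q=r\odot q^{-1}$ for nonsingular $q$. A domain is a connected open set. A bicomplex function $\psi$ is holomorphic in $G$ if at every $p\in G$ the derivative $$\psi'(p)=\lim_{\Delta p\to 0,\ \Delta p\ \text{nonsingular}}\frac{\psi(p+\Delta p)-\psi(p)}{\Delta p}$$ exists (the limit being taken over nonsingular $\Delta p$ only). Such a function has derivatives $\psi^{(k)}$ of all orders in $G$, each of them holomorphic in $G$. A curve $\Gamma$ in $\mathrm{B}$ is a piecewise continuously differentiable path $p(t)$, $r\le t\le s$, and the line integral is $\int_\Gamma\psi(p)\odot dp=\int_r^s\psi(p(t))\odot p'(t)\,dt$. *)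

theory Defs
  imports "HOL-Analysis.Analysis"
begin

text \<open>
  The library structure of the product \<^typ>\<open>complex \<times> complex\<close> already supplies the componentwise
  addition and the norm \<open>\<parallel>(a,b)\<parallel> = sqrt (\<bar>a\<bar>\<^sup>2 + \<bar>b\<bar>\<^sup>2)\<close> (fact \<open>norm_Pair\<close>).
\<close>

type_synonym bicomplex = "complex \<times> complex"

definition bc_mult :: "bicomplex \<Rightarrow> bicomplex \<Rightarrow> bicomplex" (infixl "\<odot>" 70) where
  "p \<odot> q = (fst p * fst q - snd p * snd q, snd p * fst q + fst p * snd q)"

definition bc_of_real :: "real \<Rightarrow> bicomplex" where
  "bc_of_real x = (complex_of_real x, 0)"

primrec bc_power :: "bicomplex \<Rightarrow> nat \<Rightarrow> bicomplex" where
  "bc_power p 0 = bc_of_real 1"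
| "bc_power p (Suc k) = p \<odot> bc_power p k"

definition bc_singular :: "bicomplex \<Rightarrow> bool" where
  "bc_singular p \<longleftrightarrow> (fst p)\<^sup>2 + (snd p)\<^sup>2 = 0"

text \<open>Meaningful for nonsingular arguments only; singular ones get the junk value 0.\<close>

definition bc_inverse :: "bicomplex \<Rightarrow> bicomplex" where
  "bc_inverse p = (fst p / ((fst p)\<^sup>2 + (snd p)\<^sup>2), - snd p / ((fst p)\<^sup>2 + (snd p)\<^sup>2))"

definition bc_divide :: "bicomplex \<Rightarrow> bicomplex \<Rightarrow> bicomplex" (infixl "\<oslash>" 70) where
  "r \<oslash> q = r \<odot> bc_inverse q"

definition has_bc_derivative :: "(bicomplex \<Rightarrow> bicomplex) \<Rightarrow> bicomplex \<Rightarrow> bicomplex \<Rightarrow> bool" where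
  "has_bc_derivative \<psi> D p \<longleftrightarrow>
     ((\<lambda>h. (\<psi> (p + h) - \<psi> p) \<oslash> h) \<longlongrightarrow> D) (at 0 within {h. \<not> bc_singular h})"

definition bc_holomorphic_on :: "(bicomplex \<Rightarrow> bicomplex) \<Rightarrow> bicomplex set \<Rightarrow> bool" where
  "bc_holomorphic_on \<psi> G \<longleftrightarrow> (\<forall>p\<in>G. \<exists>D. has_bc_derivative \<psi> D p)"

definition bc_deriv :: "(bicomplex \<Rightarrow> bicomplex) \<Rightarrow> bicomplex \<Rightarrow> bicomplex" where
  "bc_deriv \<psi> p = (THE D. has_bc_derivative \<psi> D p)"

abbreviation bc_higher_deriv :: "nat \<Rightarrow> (bicomplex \<Rightarrow> bicomplex) \<Rightarrow> bicomplex \<Rightarrow> bicomplex" where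
  "bc_higher_deriv k \<psi> \<equiv> (bc_deriv ^^ k) \<psi>"

definition bc_curve_in ::
    "bicomplex set \<Rightarrow> (real \<Rightarrow> bicomplex) \<Rightarrow> real \<Rightarrow> real \<Rightarrow> bicomplex \<Rightarrow> bicomplex \<Rightarrow> bool" where
  "bc_curve_in G \<gamma> r s p0 p \<longleftrightarrow>
     r \<le> s \<and> \<gamma> piecewise_C1_differentiable_on {r..s} \<and> \<gamma> ` {r..s} \<subseteq> G \<and> \<gamma> r = p0 \<and> \<gamma> s = p"

text \<open>
  As for the library's contour integrals, the values of the derivative of \<open>\<gamma>\<close> at the finitely many
  break points are irrelevant.
\<close>

definition has_bc_line_integral ::
    "(bicomplex \<Rightarrow> bicomplex) \<Rightarrow> bicomplex \<Rightarrow> (real \<Rightarrow> bicomplex) \<Rightarrow> real \<Rightarrow> real \<Rightarrow> bool" where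
  "has_bc_line_integral f I \<gamma> r s \<longleftrightarrow>
     ((\<lambda>t. f (\<gamma> t) \<odot> vector_derivative \<gamma> (at t within {r..s})) has_integral I) {r..s}"

definition bc_line_integral ::
    "(bicomplex \<Rightarrow> bicomplex) \<Rightarrow> (real \<Rightarrow> bicomplex) \<Rightarrow> real \<Rightarrow> real \<Rightarrow> bicomplex" where
  "bc_line_integral f \<gamma> r s =
     integral {r..s} (\<lambda>t. f (\<gamma> t) \<odot> vector_derivative \<gamma> (at t within {r..s}))"

definition bc_taylor_term :: "(bicomplex \<Rightarrow> bicomplex) \<Rightarrow> bicomplex \<Rightarrow> bicomplex \<Rightarrow> nat \<Rightarrow> bicomplex" where
  "bc_taylor_term \<psi> p0 p k =
     (bc_higher_deriv k \<psi> p0 \<oslash> bc_of_real (fact k)) \<odot> bc_power (p - p0) k"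

definition bc_remainder_integrand ::
    "(bicomplex \<Rightarrow> bicomplex) \<Rightarrow> bicomplex \<Rightarrow> nat \<Rightarrow> bicomplex \<Rightarrow> bicomplex" where
  "bc_remainder_integrand \<psi> p n q = bc_higher_deriv n \<psi> q \<odot> bc_power (p - q) (n - 1)"

definition bc_taylor_remainder ::
    "(bicomplex \<Rightarrow> bicomplex) \<Rightarrow> bicomplex \<Rightarrow> (real \<Rightarrow> bicomplex) \<Rightarrow> real \<Rightarrow> real \<Rightarrow> nat \<Rightarrow> bicomplex" where
  "bc_taylor_remainder \<psi> p \<gamma> r s n =
     (bc_of_real 1 \<oslash> bc_of_real (fact (n - 1)))
       \<odot> bc_line_integral (bc_remainder_integrand \<psi> p n) \<gamma> r s"

lemma bc_mult_inverse:
  assumes "\<not> bc_singular p"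
  shows "p \<odot> bc_inverse p = bc_of_real 1"
  using assms
  by (auto simp: bc_singular_def bc_mult_def bc_inverse_def bc_of_real_def power2_eq_square
        add_divide_distrib[symmetric] mult.commute)

lemma has_bc_derivative_unique:
  assumes "has_bc_derivative \<psi> D p" "has_bc_derivative \<psi> E p"
  shows "D = E"
proof -
  have "(\<lambda>n. bc_of_real (inverse (real (Suc n)))) \<longlonglongrightarrow> bc_of_real 0"
    unfolding bc_of_real_def by (intro tendsto_intros LIMSEQ_inverse_real_of_nat)
  moreover have "bc_of_real (inverse (real (Suc n))) \<in> {h. \<not> bc_singular h} - {0}" for n
    by (simp add: bc_of_real_def bc_singular_def zero_prod_def del: of_nat_Suc)
  moreover have "bc_of_real 0 = 0"
    by (simp add: bc_of_real_def zero_prod_def)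
  ultimately have "(0::bicomplex) islimpt {h. \<not> bc_singular h}"
    unfolding islimpt_sequential
    by (intro exI[of _ "\<lambda>n. bc_of_real (inverse (real (Suc n)))"]) auto
  then have "at (0::bicomplex) within {h. \<not> bc_singular h} \<noteq> bot"
    by (simp add: trivial_limit_within)
  then show ?thesis
    using assms unfolding has_bc_derivative_def by (rule tendsto_unique)
qed

lemma bc_deriv_eq: "has_bc_derivative \<psi> D p \<Longrightarrow> bc_deriv \<psi> p = D"
  unfolding bc_deriv_def using has_bc_derivative_unique by blast

end

theory Submission
  imports Defs "HOL-Complex_Analysis.Complex_Analysis"
begin

text \<open>
  For \<open>\<sigma> = \<plusminus>\<i>\<close> the map \<open>(a, b) \<mapsto> a + \<sigma> b\<close> is a ring homomorphism onto the complex numbers, and the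
  two maps together identify the bicomplex numbers with pairs of complex numbers under componentwise
  multiplication, singular meaning that some component vanishes. Although the derivative only sees
  nonsingular increments, it forces each component of \<open>\<psi>\<close> to depend, on any ball in \<open>G\<close>, on the
  corresponding component of the argument alone. So \<open>\<psi>\<close> is locally a pair of holomorphic functions of
  one complex variable, whose Taylor series give that of \<open>\<psi>\<close>; a ball of radius \<open>r\<close> projects onto
  discs of radius \<open>\<surd>2 r\<close>, so nothing of the ball is lost. For the remainder, the derivative of
  \<open>q \<mapsto> \<Sum>k<n. \<psi>\<^sup>(\<^sup>k\<^sup>)(q) (p - q)\<^sup>k / k!\<close> telescopes to \<open>\<psi>\<^sup>(\<^sup>n\<^sup>)(q) (p - q)\<^sup>n\<^sup>-\<^sup>1 / (n - 1)!\<close>, which is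
  integrated along the curve by the fundamental theorem of calculus.
\<close>

section \<open>Idempotent coordinates\<close>

definition bc_proj :: "complex \<Rightarrow> bicomplex \<Rightarrow> complex" where
  "bc_proj \<sigma> w = fst w + \<sigma> * snd w"

text \<open>For \<open>\<sigma>\<close> a square root of -1 this inverts
  \<open>w \<mapsto> (bc_proj \<sigma> w, bc_proj (-\<sigma>) w)\<close>. The parameter
  \<open>\<sigma>\<close> makes the two coordinates symmetric: what is proved for one serves for the
  other with \<open>-\<sigma>\<close>.\<close>

definition bc_join :: "complex \<Rightarrow> complex \<Rightarrow> complex \<Rightarrow> bicomplex" where
  "bc_join \<sigma> x y = ((x + y) / 2, (x - y) / (2 * \<sigma>))"

abbreviation unit_root :: "complex \<Rightarrow> bool" where
  "unit_root \<sigma> \<equiv> \<sigma> \<in> {\<i>, -\<i>}"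

lemma bounded_linear_bc_proj: "bounded_linear (bc_proj \<sigma>)"
  unfolding bc_proj_def
  by (intro bounded_linear_add bounded_linear_fst bounded_linear_snd
      bounded_linear_const_mult)

lemma bc_proj_simps [simp]:
  "bc_proj \<sigma> (z + w) = bc_proj \<sigma> z + bc_proj \<sigma> w"
  "bc_proj \<sigma> (z - w) = bc_proj \<sigma> z - bc_proj \<sigma> w"
  "bc_proj \<sigma> 0 = 0"
  "bc_proj \<sigma> (c *\<^sub>R w) = c *\<^sub>R bc_proj \<sigma> w"
  "bc_proj \<sigma> (bc_of_real c) = of_real c"
  by (auto simp: bc_proj_def bc_of_real_def algebra_simps)

lemma unit_root_uminus: "unit_root \<sigma> \<Longrightarrow> unit_root (-\<sigma>)"
  by auto

lemma bc_proj_mult: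
  "unit_root \<sigma> \<Longrightarrow> bc_proj \<sigma> (z \<odot> w) = bc_proj \<sigma> z * bc_proj \<sigma> w"
  by (auto simp: bc_proj_def bc_mult_def algebra_simps)

lemma bc_proj_power:
  "unit_root \<sigma> \<Longrightarrow> bc_proj \<sigma> (bc_power z k) = bc_proj \<sigma> z ^ k"
  by (induction k) (simp_all add: bc_proj_mult)

text \<open>The quadratic form factors as
  \<open>a\<^sup>2 + b\<^sup>2 = (a + \<sigma> b) (a - \<sigma> b)\<close>.\<close>

lemma bc_singular_iff_proj:
  "unit_root \<sigma> \<Longrightarrow> bc_singular w \<longleftrightarrow> bc_proj \<sigma> w = 0 \<or> bc_proj (-\<sigma>) w = 0"
proof -
  assume "unit_root \<sigma>"
  then have "(fst w)\<^sup>2 + (snd w)\<^sup>2 = bc_proj \<sigma> w * bc_proj (-\<sigma>) w"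
    by (auto simp: bc_proj_def algebra_simps power2_eq_square)
  then show ?thesis
    by (simp add: bc_singular_def)
qed

lemma bc_proj_divide:
  assumes "unit_root \<sigma>" "\<not> bc_singular w"
  shows "bc_proj \<sigma> (z \<oslash> w) = bc_proj \<sigma> z / bc_proj \<sigma> w"
proof -
  have "bc_proj \<sigma> w * bc_proj \<sigma> (bc_inverse w) = 1"
    using bc_mult_inverse[OF assms(2)] bc_proj_mult[OF assms(1)] by (metis bc_proj_simps(5) of_real_1)
  then have "bc_proj \<sigma> (bc_inverse w) = inverse (bc_proj \<sigma> w)"
    by (metis inverse_unique)
  then show ?thesis
    by (simp add: bc_divide_def bc_proj_mult[OF assms(1)] divide_inverse)
qed

lemma bc_proj_join:
  assumes "unit_root \<sigma>"
  shows "bc_proj \<sigma> (bc_join \<sigma> x y) = x" "bc_proj (-\<sigma>) (bc_join \<sigma> x y) = y"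
  using assms by (auto simp: bc_proj_def bc_join_def field_simps)

lemma bc_join_proj: "unit_root \<sigma> \<Longrightarrow> bc_join \<sigma> (bc_proj \<sigma> w) (bc_proj (-\<sigma>) w) = w"
  by (auto simp: bc_proj_def bc_join_def prod_eq_iff field_simps)

lemma bc_eqI:
  assumes "unit_root \<sigma>" "bc_proj \<sigma> z = bc_proj \<sigma> w" "bc_proj (-\<sigma>) z = bc_proj (-\<sigma>) w"
  shows "z = w"
  using assms bc_join_proj by metis

section \<open>Norm, balls and limits in the idempotent coordinates\<close>

text \<open>The parallelogram law for \<open>fst w\<close> and \<open>\<sigma> * snd w\<close>. It
  is the source of the factor \<open>sqrt 2\<close> in the radii below.\<close>

lemma norm_bc_proj:
  assumes "unit_root \<sigma>"
  shows "(cmod (bc_proj \<sigma> w))\<^sup>2 + (cmod (bc_proj (-\<sigma>) w))\<^sup>2 = 2 * (norm w)\<^sup>2"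
proof -
  have "(norm w)\<^sup>2 = (cmod (fst w))\<^sup>2 + (cmod (snd w))\<^sup>2"
    by (simp add: norm_prod_def)
  then show ?thesis
    using assms by (auto simp: bc_proj_def cmod_power2 power2_sum power2_diff algebra_simps)
qed

lemma bc_proj_mem_ball:
  assumes "unit_root \<sigma>" "z \<in> ball w r"
  shows "bc_proj \<sigma> z \<in> ball (bc_proj \<sigma> w) (sqrt 2 * r)"
proof -
  have "(cmod (bc_proj \<sigma> (w - z)))\<^sup>2 \<le> 2 * (norm (w - z))\<^sup>2"
    using norm_bc_proj[OF assms(1), of "w - z"] zero_le_power2[of "cmod (bc_proj (-\<sigma>) (w - z))"]
    by linarith
  also have "\<dots> = (sqrt 2 * norm (w - z))\<^sup>2"
    by (simp add: power_mult_distrib)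
  finally have "cmod (bc_proj \<sigma> (w - z)) \<le> sqrt 2 * norm (w - z)"
    by (rule power2_le_imp_le) simp
  also have "\<dots> < sqrt 2 * r"
    using assms(2) by (simp add: dist_norm)
  finally show ?thesis
    by (simp add: dist_norm)
qed

text \<open>The lift keeps the coordinate for \<open>-\<sigma>\<close> fixed, so in the norm
  identity only one square survives and the distance is exact. Hence the projection of the ball is
  the whole disc of radius \<open>sqrt 2 * r\<close>.\<close>

lemma bc_join_mem_ball:
  assumes "unit_root \<sigma>" "x \<in> ball (bc_proj \<sigma> w) (sqrt 2 * r)"
  shows "bc_join \<sigma> x (bc_proj (-\<sigma>) w) \<in> ball w r"
proof -
  let ?z = "w - bc_join \<sigma> x (bc_proj (-\<sigma>) w)"
  have "(cmod (bc_proj \<sigma> w - x))\<^sup>2 = (sqrt 2 * norm ?z)\<^sup>2"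
    using norm_bc_proj[OF assms(1), of ?z] by (simp add: bc_proj_join[OF assms(1)] power_mult_distrib)
  then have "cmod (bc_proj \<sigma> w - x) = sqrt 2 * norm ?z"
    by simp
  then show ?thesis
    using assms(2) by (simp add: dist_norm)
qed

lemma tendsto_bc_iff:
  assumes "unit_root \<sigma>"
  shows "(f \<longlongrightarrow> l) F \<longleftrightarrow>
    ((\<lambda>x. bc_proj \<sigma> (f x)) \<longlongrightarrow> bc_proj \<sigma> l) F \<and> ((\<lambda>x. bc_proj (-\<sigma>) (f x)) \<longlongrightarrow> bc_proj (-\<sigma>) l) F"
    (is "_ \<longleftrightarrow> ?R")
proof
  assume "(f \<longlongrightarrow> l) F"
  then show ?R
    by (blast intro: bounded_linear.tendsto[OF bounded_linear_bc_proj])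
next
  assume R: ?R
  have "\<sigma> \<noteq> 0"
    using assms by auto
  then have "((\<lambda>x. bc_join \<sigma> (bc_proj \<sigma> (f x)) (bc_proj (-\<sigma>) (f x))) \<longlongrightarrow>
      bc_join \<sigma> (bc_proj \<sigma> l) (bc_proj (-\<sigma>) l)) F"
    unfolding bc_join_def using R by (intro tendsto_intros) auto
  then show "(f \<longlongrightarrow> l) F"
    using bc_join_proj[OF assms] by simp
qed

section \<open>Local splitting of holomorphic functions\<close>

text \<open>The projected difference quotient converges and is therefore bounded near 0. The gain is
  that the bound contains one coordinate of \<open>h\<close> only, however large the other
  coordinate is in comparison.\<close>

lemma has_bc_derivative_proj_bound:
  assumes "unit_root \<sigma>" "has_bc_derivative \<psi> D w"
  obtains C d where "d > 0"
    "\<And>h. \<not> bc_singular h \<Longrightarrow> norm h < d \<Longrightarrow>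
       cmod (bc_proj \<sigma> (\<psi> (w + h)) - bc_proj \<sigma> (\<psi> w)) \<le> C * cmod (bc_proj \<sigma> h)"
proof -
  have "((\<lambda>h. bc_proj \<sigma> ((\<psi> (w + h) - \<psi> w) \<oslash> h)) \<longlongrightarrow> bc_proj \<sigma> D) (at 0 within {h. \<not> bc_singular h})"
    using assms(2) unfolding has_bc_derivative_def
    by (rule bounded_linear.tendsto[OF bounded_linear_bc_proj])
  from tendstoD[OF this zero_less_one]
  obtain d where d: "d > 0" "\<And>h. \<not> bc_singular h \<Longrightarrow> h \<noteq> 0 \<Longrightarrow> norm h < d \<Longrightarrow>
      dist (bc_proj \<sigma> ((\<psi> (w + h) - \<psi> w) \<oslash> h)) (bc_proj \<sigma> D) < 1"
    unfolding eventually_at by auto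
  show ?thesis
  proof
    fix h assume h: "\<not> bc_singular h" "norm h < d"
    have nz: "bc_proj \<sigma> h \<noteq> 0"
      using h bc_singular_iff_proj[OF assms(1)] by auto
    then have "h \<noteq> 0" by auto
    then have "cmod ((bc_proj \<sigma> (\<psi> (w + h)) - bc_proj \<sigma> (\<psi> w)) / bc_proj \<sigma> h - bc_proj \<sigma> D) < 1"
      using d(2)[OF h(1) _ h(2)] by (simp add: dist_norm bc_proj_divide[OF assms(1) h(1)])
    then have "cmod ((bc_proj \<sigma> (\<psi> (w + h)) - bc_proj \<sigma> (\<psi> w)) / bc_proj \<sigma> h) \<le> cmod (bc_proj \<sigma> D) + 1"
      by (smt (verit) norm_triangle_sub)
    then show "cmod (bc_proj \<sigma> (\<psi> (w + h)) - bc_proj \<sigma> (\<psi> w)) \<le> (cmod (bc_proj \<sigma> D) + 1) * cmod (bc_proj \<sigma> h)"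
      using nz by (simp add: norm_divide divide_le_eq)
  qed (use d in simp)
qed

text \<open>
  Reach \<open>w + k\<close> along \<open>w + k + e\<close> with \<open>e\<close> a small positive real: both \<open>e\<close>, as an increment
  from \<open>w + k\<close>, and \<open>k + e\<close>, as an increment from \<open>w\<close>, are nonsingular with projection \<open>e\<close>.
\<close>

lemma bc_proj_locally_constant:
  assumes "unit_root \<sigma>" "open G" "bc_holomorphic_on \<psi> G" "w \<in> G"
  obtains d where "d > 0"
    "\<And>k. norm k < d \<Longrightarrow> bc_proj \<sigma> k = 0 \<Longrightarrow> bc_proj \<sigma> (\<psi> (w + k)) = bc_proj \<sigma> (\<psi> w)"
proof -
  obtain D where "has_bc_derivative \<psi> D w"
    using assms unfolding bc_holomorphic_on_def by blast
  then obtain C d where d: "d > 0" "\<And>h. \<not> bc_singular h \<Longrightarrow> norm h < d \<Longrightarrow>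
       cmod (bc_proj \<sigma> (\<psi> (w + h)) - bc_proj \<sigma> (\<psi> w)) \<le> C * cmod (bc_proj \<sigma> h)"
    by (rule has_bc_derivative_proj_bound[OF assms(1)]) blast
  obtain e where e: "e > 0" "ball w e \<subseteq> G"
    using assms(2,4) openE by blast
  show ?thesis
  proof
    show "min d e > 0" using d e by simp
    fix k assume k: "norm k < min d e" "bc_proj \<sigma> k = 0"
    show "bc_proj \<sigma> (\<psi> (w + k)) = bc_proj \<sigma> (\<psi> w)"
    proof (cases "k = 0")
      case False
      then have k': "bc_proj (-\<sigma>) k \<noteq> 0"
        using bc_eqI[OF assms(1), of k 0] k by auto
      have "w + k \<in> G"
        using e k by (auto simp: dist_norm)
      then obtain E where "has_bc_derivative \<psi> E (w + k)"
        using assms unfolding bc_holomorphic_on_def by blast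
      then obtain C' d' where d': "d' > 0" "\<And>h. \<not> bc_singular h \<Longrightarrow> norm h < d' \<Longrightarrow>
           cmod (bc_proj \<sigma> (\<psi> (w + k + h)) - bc_proj \<sigma> (\<psi> (w + k))) \<le> C' * cmod (bc_proj \<sigma> h)"
        by (rule has_bc_derivative_proj_bound[OF assms(1)]) blast
      define h where "h = (\<lambda>n. bc_of_real (inverse (real (Suc n))))"
      have h0: "h \<longlonglongrightarrow> 0"
      proof -
        have "h \<longlonglongrightarrow> bc_of_real 0"
          unfolding h_def bc_of_real_def by (intro tendsto_intros LIMSEQ_inverse_real_of_nat)
        then show ?thesis by (simp add: bc_of_real_def zero_prod_def)
      qed
      have ph: "(\<lambda>n. cmod (bc_proj \<sigma> (h n))) \<longlonglongrightarrow> 0"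
        using bounded_linear.tendsto[OF bounded_linear_bc_proj h0, of \<sigma>] by (auto intro: tendsto_norm_zero)
      have nzh: "bc_proj s (h n) \<noteq> 0" for s n
        by (simp add: h_def del: of_nat_Suc)
      have ev1: "\<forall>\<^sub>F n in sequentially. norm (h n) < d'"
        using tendstoD[OF h0 d'(1)] by simp
      have ev2: "\<forall>\<^sub>F n in sequentially. norm (k + h n) < d"
      proof -
        have "(\<lambda>n. norm (k + h n)) \<longlonglongrightarrow> norm (k + 0)"
          by (intro tendsto_intros h0)
        then show ?thesis using k(1) by (auto intro: order_tendstoD(2))
      qed
      \<comment> \<open>The coordinate of \<open>k + h n\<close> for \<open>\<sigma>\<close> is that
        of \<open>h n\<close>, hence nonzero; together with this fact \<open>k + h n\<close> is
        eventually nonsingular.\<close>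
      have ev3: "\<forall>\<^sub>F n in sequentially. bc_proj (-\<sigma>) (k + h n) \<noteq> 0"
      proof -
        have "(\<lambda>n. bc_proj (-\<sigma>) (k + h n)) \<longlonglongrightarrow> bc_proj (-\<sigma>) (k + 0)"
          by (intro bounded_linear.tendsto[OF bounded_linear_bc_proj] tendsto_intros h0)
        then show ?thesis using k' by (intro tendsto_imp_eventually_ne) auto
      qed
      have A: "(\<lambda>n. bc_proj \<sigma> (\<psi> (w + k + h n)) - bc_proj \<sigma> (\<psi> (w + k))) \<longlonglongrightarrow> 0"
      proof (rule Lim_null_comparison)
        show "\<forall>\<^sub>F n in sequentially. cmod (bc_proj \<sigma> (\<psi> (w + k + h n)) - bc_proj \<sigma> (\<psi> (w + k)))
            \<le> C' * cmod (bc_proj \<sigma> (h n))"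
          using ev1 by eventually_elim (use d'(2) nzh bc_singular_iff_proj[OF assms(1)] in blast)
        show "(\<lambda>n. C' * cmod (bc_proj \<sigma> (h n))) \<longlonglongrightarrow> 0"
          using tendsto_mult_left[OF ph, of C'] by simp
      qed
      have B: "(\<lambda>n. bc_proj \<sigma> (\<psi> (w + k + h n)) - bc_proj \<sigma> (\<psi> w)) \<longlonglongrightarrow> 0"
      proof (rule Lim_null_comparison)
        show "\<forall>\<^sub>F n in sequentially. cmod (bc_proj \<sigma> (\<psi> (w + k + h n)) - bc_proj \<sigma> (\<psi> w))
            \<le> C * cmod (bc_proj \<sigma> (h n))"
          using ev2 ev3
        proof eventually_elim
          case (elim n)
          have "\<not> bc_singular (k + h n)"
            using elim k(2) nzh[of \<sigma> n] bc_singular_iff_proj[OF assms(1)] by auto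
          from d(2)[OF this elim(1)] show ?case
            using k(2) by (simp add: add.assoc)
        qed
        show "(\<lambda>n. C * cmod (bc_proj \<sigma> (h n))) \<longlonglongrightarrow> 0"
          using tendsto_mult_left[OF ph, of C] by simp
      qed
      \<comment> \<open>The difference of the two null sequences is the constant \<open>bc_proj
        \<sigma> (\<psi> (w + k)) - bc_proj \<sigma> (\<psi> w)\<close>.\<close>
      show ?thesis
        using tendsto_diff[OF B A] by (simp add: LIMSEQ_const_iff)
    qed simp
  qed
qed

text \<open>The part of a convex set on which \<open>bc_proj \<sigma>\<close> has a given value is
  convex, hence connected, so local constancy along it becomes constancy. In a general domain such a
  fibre may be disconnected.\<close>

lemma bc_proj_constant_on_convex:
  assumes "unit_root \<sigma>" "open G" "bc_holomorphic_on \<psi> G" "convex S" "S \<subseteq> G"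
    and "z \<in> S" "w \<in> S" "bc_proj \<sigma> z = bc_proj \<sigma> w"
  shows "bc_proj \<sigma> (\<psi> z) = bc_proj \<sigma> (\<psi> w)"
proof -
  define T where "T = S \<inter> {x. bc_proj \<sigma> x = bc_proj \<sigma> w}"
  have "convex {x. bc_proj \<sigma> x = bc_proj \<sigma> w}"
    by (auto simp: convex_def simp flip: scaleR_left_distrib)
  then have "convex T"
    unfolding T_def using assms(4) by (rule convex_Int[rotated])
  have "(\<lambda>x. bc_proj \<sigma> (\<psi> x)) constant_on T"
  proof (rule locally_constant_imp_constant)
    show "connected T"
      using \<open>convex T\<close> by (rule convex_connected)
    fix a assume a: "a \<in> T"
    then obtain d where d: "d > 0"
      "\<And>k. norm k < d \<Longrightarrow> bc_proj \<sigma> k = 0 \<Longrightarrow> bc_proj \<sigma> (\<psi> (a + k)) = bc_proj \<sigma> (\<psi> a)"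
      using bc_proj_locally_constant[OF assms(1-3), of a] assms(5) unfolding T_def by blast
    have "bc_proj \<sigma> (\<psi> x) = bc_proj \<sigma> (\<psi> a)" if "x \<in> T" "dist x a < d" for x
      using d(2)[of "x - a"] a that by (auto simp: T_def dist_norm)
    then have "\<forall>x\<in>T \<inter> ball a d. bc_proj \<sigma> (\<psi> x) = bc_proj \<sigma> (\<psi> a)"
      by (auto simp: dist_commute)
    moreover have "openin (top_of_set T) (T \<inter> ball a d)"
      by (simp add: openin_open_Int)
    moreover have "a \<in> T \<inter> ball a d" using a d by simp
    ultimately show "\<exists>U. openin (top_of_set T) U \<and> a \<in> U \<and> (\<forall>x\<in>U. bc_proj \<sigma> (\<psi> x) = bc_proj \<sigma> (\<psi> a))"
      by blast
  qed
  moreover have "z \<in> T" "w \<in> T"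
    using assms by (auto simp: T_def)
  ultimately show ?thesis
    by (auto simp: constant_on_def)
qed

section \<open>Passing between bicomplex and complex derivatives\<close>

text \<open>Increments \<open>(x, 0)\<close> with \<open>x \<noteq> 0\<close> are nonsingular and
  have both projections equal to \<open>x\<close>, so along them the projected bicomplex quotient is
  the complex difference quotient of \<open>f\<close>.\<close>

lemma has_field_derivative_bc_proj:
  assumes "unit_root \<sigma>" "has_bc_derivative \<psi> D w"
    and "\<forall>\<^sub>F z in nhds w. bc_proj \<sigma> (\<psi> z) = f (bc_proj \<sigma> z)"
  shows "(f has_field_derivative bc_proj \<sigma> D) (at (bc_proj \<sigma> w))"
proof -
  define \<iota> where "\<iota> = (\<lambda>x. (x, 0) :: bicomplex)"
  have lim0: "\<iota> \<midarrow>0\<rightarrow> 0"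
    unfolding \<iota>_def zero_prod_def by (intro tendsto_intros)
  have proj: "bc_proj s (\<iota> x) = x" for s x
    by (simp add: bc_proj_def \<iota>_def)
  have nonsing: "\<not> bc_singular (\<iota> x)" if "x \<noteq> 0" for x
    using that by (simp add: \<iota>_def bc_singular_def)
  have "filterlim \<iota> (at 0 within {h. \<not> bc_singular h}) (at 0)"
    unfolding filterlim_at using lim0 nonsing
    by (auto simp: eventually_at_filter \<iota>_def zero_prod_def)
  from filterlim_compose[OF assms(2)[unfolded has_bc_derivative_def] this]
  have L: "((\<lambda>x. bc_proj \<sigma> ((\<psi> (w + \<iota> x) - \<psi> w) \<oslash> \<iota> x)) \<longlongrightarrow> bc_proj \<sigma> D) (at 0)"
    by (rule bounded_linear.tendsto[OF bounded_linear_bc_proj])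
  have "filterlim (\<lambda>x. w + \<iota> x) (nhds w) (at 0)"
    using tendsto_add[OF tendsto_const lim0, of w] by simp
  from eventually_compose_filterlim[OF assms(3) this]
  have ev: "\<forall>\<^sub>F x in at 0. bc_proj \<sigma> (\<psi> (w + \<iota> x)) = f (bc_proj \<sigma> (w + \<iota> x))" .
  have ev0: "\<forall>\<^sub>F x in at 0. x \<noteq> (0::complex)"
    by (simp add: eventually_at_filter)
  have eq: "bc_proj \<sigma> (\<psi> w) = f (bc_proj \<sigma> w)"
    using assms(3) by (rule eventually_nhds_x_imp_x)
  have "\<forall>\<^sub>F x in at 0. bc_proj \<sigma> ((\<psi> (w + \<iota> x) - \<psi> w) \<oslash> \<iota> x)
      = (f (bc_proj \<sigma> w + x) - f (bc_proj \<sigma> w)) / x"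
    using ev ev0 by eventually_elim (simp add: bc_proj_divide[OF assms(1) nonsing] proj eq)
  with L show ?thesis
    unfolding DERIV_def by (rule Lim_transform_eventually)
qed

text \<open>
  A Frechet derivative of the form \<open>(\<odot>) D\<close> at \<open>w\<close> would not suffice here: near the singular cone
  \<open>norm (bc_inverse h)\<close> is not \<open>O(1 / norm h)\<close>.
\<close>

lemma has_bc_derivative_join:
  assumes "unit_root \<sigma>"
    and f: "(f has_field_derivative f') (at (bc_proj \<sigma> w))"
    and g: "(g has_field_derivative g') (at (bc_proj (-\<sigma>) w))"
    and ev: "\<forall>\<^sub>F z in nhds w. bc_proj \<sigma> (\<psi> z) = f (bc_proj \<sigma> z) \<and> bc_proj (-\<sigma>) (\<psi> z) = g (bc_proj (-\<sigma>) z)"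
  shows "has_bc_derivative \<psi> (bc_join \<sigma> f' g') w"
proof -
  let ?F = "at 0 within {h. \<not> bc_singular h}"
  have aux: "((\<lambda>h. bc_proj s ((\<psi> (w + h) - \<psi> w) \<oslash> h)) \<longlongrightarrow> k') ?F"
    if s: "unit_root s" and k: "(k has_field_derivative k') (at (bc_proj s w))"
      and evk: "\<forall>\<^sub>F z in nhds w. bc_proj s (\<psi> z) = k (bc_proj s z)" for s k k'
  proof -
    have lim0: "((\<lambda>h. h) \<longlongrightarrow> 0) ?F"
      by (rule tendsto_ident_at)
    have nz: "\<forall>\<^sub>F h in ?F. \<not> bc_singular h"
      by (simp add: eventually_at_filter)
    \<comment> \<open>Nonsingular increments have nonzero projections, so the limit of the complex
      difference quotient of \<open>k\<close> can be composed with \<open>bc_proj s\<close>.\<close>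
    have "filterlim (bc_proj s) (at 0) ?F"
      unfolding filterlim_at
      using bounded_linear.tendsto[OF bounded_linear_bc_proj lim0, of s] nz bc_singular_iff_proj[OF s]
      by (auto elim: eventually_mono)
    from filterlim_compose[OF k[unfolded DERIV_def] this]
    have L: "((\<lambda>h. (k (bc_proj s w + bc_proj s h) - k (bc_proj s w)) / bc_proj s h) \<longlongrightarrow> k') ?F" .
    have "filterlim (\<lambda>h. w + h) (nhds w) ?F"
      using tendsto_add[OF tendsto_const lim0, of w] by simp
    from eventually_compose_filterlim[OF evk this]
    have ev': "\<forall>\<^sub>F h in ?F. bc_proj s (\<psi> (w + h)) = k (bc_proj s (w + h))" .
    have eq: "bc_proj s (\<psi> w) = k (bc_proj s w)"
      using evk by (rule eventually_nhds_x_imp_x)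
    have "\<forall>\<^sub>F h in ?F. (k (bc_proj s w + bc_proj s h) - k (bc_proj s w)) / bc_proj s h
        = bc_proj s ((\<psi> (w + h) - \<psi> w) \<oslash> h)"
      using ev' nz by eventually_elim (simp add: bc_proj_divide[OF s] eq)
    with L show ?thesis
      by (rule Lim_transform_eventually)
  qed
  have "\<forall>\<^sub>F z in nhds w. bc_proj \<sigma> (\<psi> z) = f (bc_proj \<sigma> z)"
    "\<forall>\<^sub>F z in nhds w. bc_proj (-\<sigma>) (\<psi> z) = g (bc_proj (-\<sigma>) z)"
    using ev by (simp_all add: eventually_conj_iff)
  then show ?thesis
    unfolding has_bc_derivative_def tendsto_bc_iff[OF assms(1)] bc_proj_join[OF assms(1)]
    using aux[OF assms(1) f] aux[OF unit_root_uminus[OF assms(1)] g] by blast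
qed

text \<open>Take \<open>f\<close> to be the projection of \<open>\<psi>\<close> on the slice through
  \<open>w\<close> with the other coordinate frozen. A point of the ball and its lift from the slice
  share the coordinate for \<open>\<sigma>\<close>, so constancy on fibres of the convex ball
  carries the identity from the slice to the ball.\<close>

lemma bc_holomorphic_proj_on_ball:
  assumes "unit_root \<sigma>" "open G" "bc_holomorphic_on \<psi> G" "ball w r \<subseteq> G"
  obtains f where "f holomorphic_on ball (bc_proj \<sigma> w) (sqrt 2 * r)"
    "\<And>z. z \<in> ball w r \<Longrightarrow> bc_proj \<sigma> (\<psi> z) = f (bc_proj \<sigma> z)"
proof
  define J where "J = (\<lambda>x. bc_join \<sigma> x (bc_proj (-\<sigma>) w))"
  define f where "f = (\<lambda>x. bc_proj \<sigma> (\<psi> (J x)))"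
  have J: "J x \<in> ball w r" "bc_proj \<sigma> (J x) = x" if "x \<in> ball (bc_proj \<sigma> w) (sqrt 2 * r)" for x
    using bc_join_mem_ball[OF assms(1) that] bc_proj_join[OF assms(1)] by (auto simp: J_def)
  show eq: "bc_proj \<sigma> (\<psi> z) = f (bc_proj \<sigma> z)" if z: "z \<in> ball w r" for z
    unfolding f_def
    by (rule bc_proj_constant_on_convex[OF assms(1-3) convex_ball assms(4) z])
       (use J bc_proj_mem_ball[OF assms(1) z] in auto)
  have "f field_differentiable at x" if x: "x \<in> ball (bc_proj \<sigma> w) (sqrt 2 * r)" for x
  proof -
    obtain D where D: "has_bc_derivative \<psi> D (J x)"
      using assms(3,4) J(1)[OF x] unfolding bc_holomorphic_on_def by blast
    have "\<forall>\<^sub>F z in nhds (J x). bc_proj \<sigma> (\<psi> z) = f (bc_proj \<sigma> z)"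
      using eventually_nhds_in_open[OF open_ball J(1)[OF x]] by eventually_elim (rule eq)
    from has_field_derivative_bc_proj[OF assms(1) D this] show ?thesis
      unfolding J(2)[OF x] field_differentiable_def by blast
  qed
  then show "f holomorphic_on ball (bc_proj \<sigma> w) (sqrt 2 * r)"
    by (simp add: holomorphic_on_def field_differentiable_at_within)
qed

text \<open>One pair \<open>f\<close>, \<open>g\<close> represents the derivatives of all orders, by
  induction on the order. Complex holomorphy of \<open>f\<close> and \<open>g\<close> supplies the
  existence of each further bicomplex derivative.\<close>

lemma bc_holomorphic_split_on_ball:
  assumes "unit_root \<sigma>" "open G" "bc_holomorphic_on \<psi> G" "ball w r \<subseteq> G"
  obtains f g where
    "f holomorphic_on ball (bc_proj \<sigma> w) (sqrt 2 * r)"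
    "g holomorphic_on ball (bc_proj (-\<sigma>) w) (sqrt 2 * r)"
    "\<And>k z. z \<in> ball w r \<Longrightarrow> bc_proj \<sigma> (bc_higher_deriv k \<psi> z) = (deriv ^^ k) f (bc_proj \<sigma> z)"
    "\<And>k z. z \<in> ball w r \<Longrightarrow> bc_proj (-\<sigma>) (bc_higher_deriv k \<psi> z) = (deriv ^^ k) g (bc_proj (-\<sigma>) z)"
proof -
  note neg = unit_root_uminus[OF assms(1)]
  obtain f where f: "f holomorphic_on ball (bc_proj \<sigma> w) (sqrt 2 * r)"
    "\<And>z. z \<in> ball w r \<Longrightarrow> bc_proj \<sigma> (\<psi> z) = f (bc_proj \<sigma> z)"
    using bc_holomorphic_proj_on_ball[OF assms] by blast
  obtain g where g: "g holomorphic_on ball (bc_proj (-\<sigma>) w) (sqrt 2 * r)"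
    "\<And>z. z \<in> ball w r \<Longrightarrow> bc_proj (-\<sigma>) (\<psi> z) = g (bc_proj (-\<sigma>) z)"
    using bc_holomorphic_proj_on_ball[OF neg assms(2-)] by blast
  \<comment> \<open>The splitting of order \<open>k\<close> is assumed on the whole ball, since
    differentiating at \<open>z\<close> uses it in a neighbourhood of \<open>z\<close>. Existence
    must be shown before the description in \<open>bc_deriv\<close> can be evaluated.\<close>
  have step: "has_bc_derivative (bc_higher_deriv k \<psi>)
      (bc_join \<sigma> ((deriv ^^ Suc k) f (bc_proj \<sigma> z)) ((deriv ^^ Suc k) g (bc_proj (-\<sigma>) z))) z"
    if z: "z \<in> ball w r" and IH: "\<And>z. z \<in> ball w r \<Longrightarrow>
        bc_proj \<sigma> (bc_higher_deriv k \<psi> z) = (deriv ^^ k) f (bc_proj \<sigma> z) \<and>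
        bc_proj (-\<sigma>) (bc_higher_deriv k \<psi> z) = (deriv ^^ k) g (bc_proj (-\<sigma>) z)" for k z
  proof (rule has_bc_derivative_join[OF assms(1)])
    show "((deriv ^^ k) f has_field_derivative (deriv ^^ Suc k) f (bc_proj \<sigma> z)) (at (bc_proj \<sigma> z))"
      using holomorphic_derivI[OF holomorphic_higher_deriv[OF f(1) open_ball] open_ball
          bc_proj_mem_ball[OF assms(1) z]] by simp
    show "((deriv ^^ k) g has_field_derivative (deriv ^^ Suc k) g (bc_proj (-\<sigma>) z)) (at (bc_proj (-\<sigma>) z))"
      using holomorphic_derivI[OF holomorphic_higher_deriv[OF g(1) open_ball] open_ball
          bc_proj_mem_ball[OF neg z]] by simp
    show "\<forall>\<^sub>F z in nhds z. bc_proj \<sigma> (bc_higher_deriv k \<psi> z) = (deriv ^^ k) f (bc_proj \<sigma> z) \<and>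
        bc_proj (-\<sigma>) (bc_higher_deriv k \<psi> z) = (deriv ^^ k) g (bc_proj (-\<sigma>) z)"
      using eventually_nhds_in_open[OF open_ball z] by eventually_elim (rule IH)
  qed
  have split: "bc_proj \<sigma> (bc_higher_deriv k \<psi> z) = (deriv ^^ k) f (bc_proj \<sigma> z) \<and>
        bc_proj (-\<sigma>) (bc_higher_deriv k \<psi> z) = (deriv ^^ k) g (bc_proj (-\<sigma>) z)"
    if "z \<in> ball w r" for k z
    using that
  proof (induction k arbitrary: z)
    case 0
    then show ?case using f(2) g(2) by simp
  next
    case (Suc k)
    from bc_deriv_eq[OF step[OF Suc.prems Suc.IH]] show ?case
      by (simp add: bc_proj_join[OF assms(1)])
  qed
  with f g split show ?thesis
    using that by blast
qed

text \<open>Increments along a curve may be singular, so the chain rule needs a full Frechet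
  derivative in place of the limit over nonsingular increments. It is obtained from the chain rule
  for the two complex components.\<close>

lemma bc_higher_deriv_has_derivative:
  assumes "open G" "bc_holomorphic_on \<psi> G" "w \<in> G"
  shows "(bc_higher_deriv k \<psi> has_derivative (\<odot>) (bc_higher_deriv (Suc k) \<psi> w)) (at w)"
proof -
  obtain r where r: "r > 0" "ball w r \<subseteq> G"
    using assms openE by blast
  have i: "unit_root \<i>" by simp
  obtain f g where fg: "f holomorphic_on ball (bc_proj \<i> w) (sqrt 2 * r)"
    "g holomorphic_on ball (bc_proj (-\<i>) w) (sqrt 2 * r)"
    "\<And>k z. z \<in> ball w r \<Longrightarrow> bc_proj \<i> (bc_higher_deriv k \<psi> z) = (deriv ^^ k) f (bc_proj \<i> z)"
    "\<And>k z. z \<in> ball w r \<Longrightarrow> bc_proj (-\<i>) (bc_higher_deriv k \<psi> z) = (deriv ^^ k) g (bc_proj (-\<i>) z)"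
    by (rule bc_holomorphic_split_on_ball[OF i assms(1,2) r(2)]) blast
  have w: "w \<in> ball w r" using r by simp
  have deriv: "((\<lambda>z. (deriv ^^ k) h (bc_proj s z)) has_derivative (\<lambda>v. (deriv ^^ Suc k) h (bc_proj s w) * bc_proj s v)) (at w)"
    if "unit_root s" "h holomorphic_on ball (bc_proj s w) (sqrt 2 * r)" for s h
  proof -
    have "((deriv ^^ k) h has_derivative (*) ((deriv ^^ Suc k) h (bc_proj s w))) (at (bc_proj s w))"
      using holomorphic_derivI[OF holomorphic_higher_deriv[OF that(2) open_ball] open_ball
          bc_proj_mem_ball[OF that(1) w]] by (simp add: has_field_derivative_def)
    from has_derivative_compose[OF bounded_linear_imp_has_derivative[OF bounded_linear_bc_proj] this]
    show ?thesis .
  qed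
  let ?f = "(deriv ^^ k) f" and ?g = "(deriv ^^ k) g"
  let ?f' = "(deriv ^^ Suc k) f (bc_proj \<i> w)" and ?g' = "(deriv ^^ Suc k) g (bc_proj (-\<i>) w)"
  have "((\<lambda>z. bc_join \<i> (?f (bc_proj \<i> z)) (?g (bc_proj (-\<i>) z))) has_derivative
      (\<lambda>v. bc_join \<i> (?f' * bc_proj \<i> v) (?g' * bc_proj (-\<i>) v))) (at w)"
    unfolding bc_join_def divide_inverse
    by (intro has_derivative_Pair has_derivative_mult_left has_derivative_add has_derivative_diff
        deriv i fg(1,2) unit_root_uminus)
  moreover have "bc_join \<i> (?f' * bc_proj \<i> v) (?g' * bc_proj (-\<i>) v) = bc_higher_deriv (Suc k) \<psi> w \<odot> v" for v
    using bc_join_proj[OF i, of "bc_higher_deriv (Suc k) \<psi> w \<odot> v"]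
      fg(3,4)[OF w, of "Suc k"] bc_proj_mult[OF i] bc_proj_mult[OF unit_root_uminus[OF i]] by metis
  ultimately have "((\<lambda>z. bc_join \<i> (?f (bc_proj \<i> z)) (?g (bc_proj (-\<i>) z))) has_derivative
      (\<odot>) (bc_higher_deriv (Suc k) \<psi> w)) (at w)"
    by simp
  then show ?thesis
  proof (rule has_derivative_transform_within_open[OF _ open_ball w])
    fix z assume z: "z \<in> ball w r"
    show "bc_join \<i> (?f (bc_proj \<i> z)) (?g (bc_proj (-\<i>) z)) = bc_higher_deriv k \<psi> z"
      using bc_join_proj[OF i, of "bc_higher_deriv k \<psi> z"] fg(3,4)[OF z] by metis
  qed
qed

section \<open>Taylor's formula\<close>

lemma bounded_bilinear_bc_mult: "bounded_bilinear (\<odot>)"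
  unfolding bilinear_conv_bounded_bilinear[symmetric] bilinear_def
  by (auto intro!: linearI simp: bc_mult_def scaleR_prod_def algebra_simps)

interpretation bc_mult: bounded_bilinear "(\<odot>)"
  by (rule bounded_bilinear_bc_mult)

lemma bc_mult_commute: "z \<odot> w = w \<odot> z"
  by (simp add: bc_mult_def algebra_simps)

lemma bc_mult_assoc: "(z \<odot> w) \<odot> v = z \<odot> (w \<odot> v)"
  by (simp add: bc_mult_def algebra_simps)

lemma bc_mult_of_real: "bc_of_real c \<odot> z = c *\<^sub>R z"
  by (simp add: bc_mult_def bc_of_real_def scaleR_prod_def scaleR_conv_of_real)

lemma bc_divide_of_real: "z \<oslash> bc_of_real c = inverse c *\<^sub>R z"
  \<comment> \<open>For \<open>c = 0\<close> both sides are 0, by the convention for division by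
    zero.\<close>
  by (cases "c = 0") (simp_all add: bc_divide_def bc_inverse_def bc_mult_def bc_of_real_def
      scaleR_prod_def scaleR_conv_of_real power2_eq_square field_simps)

section \<open>Differentiating the Taylor polynomial in its centre\<close>

lemma bc_power_has_derivative:
  "((\<lambda>q. bc_power (p - q) (Suc k)) has_derivative (\<odot>) (- real (Suc k) *\<^sub>R bc_power (p - w) k)) (at w)"
proof (induction k)
  case 0
  have "((\<lambda>q. p - q) has_derivative (\<lambda>h. - h)) (at w)"
    by (auto intro!: derivative_eq_intros)
  then show ?case
    by (simp add: bc_mult_commute[of _ "bc_of_real 1"] bc_mult_of_real bc_mult.minus_left)
next
  case (Suc k)
  have "((\<lambda>q. p - q) has_derivative (\<lambda>h. - h)) (at w)"
    by (auto intro!: derivative_eq_intros)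
  from bc_mult.FDERIV[OF this Suc.IH]
  have "((\<lambda>q. bc_power (p - q) (Suc (Suc k))) has_derivative
      (\<lambda>h. (p - w) \<odot> (- real (Suc k) *\<^sub>R bc_power (p - w) k \<odot> h) + - h \<odot> bc_power (p - w) (Suc k))) (at w)"
    by simp
  moreover have "(p - w) \<odot> (- real (Suc k) *\<^sub>R bc_power (p - w) k \<odot> h) + - h \<odot> bc_power (p - w) (Suc k)
      = - real (Suc (Suc k)) *\<^sub>R bc_power (p - w) (Suc k) \<odot> h" for h
  proof -
    let ?X = "(p - w) \<odot> (bc_power (p - w) k \<odot> h)"
    have "(p - w) \<odot> (- real (Suc k) *\<^sub>R bc_power (p - w) k \<odot> h) = - (real (Suc k) *\<^sub>R ?X)"
      by (simp add: bc_mult.scaleR_left bc_mult.scaleR_right bc_mult.minus_left bc_mult.minus_right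
          del: of_nat_Suc)
    moreover have "- h \<odot> bc_power (p - w) (Suc k) = - ?X"
      by (simp add: bc_mult.minus_left bc_mult_commute[of h] bc_mult_assoc)
    moreover have "- real (Suc (Suc k)) *\<^sub>R bc_power (p - w) (Suc k) \<odot> h = - (real (Suc (Suc k)) *\<^sub>R ?X)"
      by (simp add: bc_mult.scaleR_left bc_mult.minus_left bc_mult_assoc del: of_nat_Suc)
    ultimately show ?thesis
      by (simp add: scaleR_left_distrib scaleR_2)
  qed
  ultimately show ?case
    by simp
qed

lemma bc_taylor_term_eq:
  "bc_taylor_term \<psi> q p k = inverse (fact k) *\<^sub>R (bc_higher_deriv k \<psi> q \<odot> bc_power (p - q) k)"
  by (simp add: bc_taylor_term_def bc_divide_of_real bc_mult.scaleR_left)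

text \<open>The centre \<open>q\<close> varies while \<open>p\<close> is fixed. A new term
  contributes two parts by the product rule: the derivative of the power cancels the derivative of
  the sum so far, and the derivative of the coefficient is what remains.\<close>

lemma bc_taylor_polynomial_has_derivative:
  assumes "open G" "bc_holomorphic_on \<psi> G" "w \<in> G"
  shows "((\<lambda>q. \<Sum>k<Suc n. bc_taylor_term \<psi> q p k) has_derivative
    (\<odot>) (inverse (fact n) *\<^sub>R bc_remainder_integrand \<psi> p (Suc n) w)) (at w)"
proof (induction n)
  case 0
  then show ?case
    using bc_higher_deriv_has_derivative[OF assms, of 0]
    by (simp add: bc_taylor_term_eq bc_remainder_integrand_def
        bc_mult_commute[of _ "bc_of_real 1"] bc_mult_of_real)
next
  case (Suc n)
  let ?D = "\<lambda>k. bc_higher_deriv k \<psi>" and ?P = "bc_power (p - w)"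
  have "((\<lambda>q. (\<Sum>k<Suc n. bc_taylor_term \<psi> q p k) + bc_taylor_term \<psi> q p (Suc n)) has_derivative
      (\<lambda>h. inverse (fact n) *\<^sub>R bc_remainder_integrand \<psi> p (Suc n) w \<odot> h +
        inverse (fact (Suc n)) *\<^sub>R (?D (Suc n) w \<odot> (- real (Suc n) *\<^sub>R ?P n \<odot> h) +
          (?D (Suc (Suc n)) w \<odot> h) \<odot> ?P (Suc n)))) (at w)"
    unfolding bc_taylor_term_eq[of \<psi> _ p "Suc n"]
    by (intro has_derivative_add Suc.IH has_derivative_scaleR_right bc_mult.FDERIV
        bc_higher_deriv_has_derivative[OF assms] bc_power_has_derivative)
  moreover have "inverse (fact n) *\<^sub>R bc_remainder_integrand \<psi> p (Suc n) w \<odot> h +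
        inverse (fact (Suc n)) *\<^sub>R (?D (Suc n) w \<odot> (- real (Suc n) *\<^sub>R ?P n \<odot> h) +
          (?D (Suc (Suc n)) w \<odot> h) \<odot> ?P (Suc n))
      = inverse (fact (Suc n)) *\<^sub>R bc_remainder_integrand \<psi> p (Suc (Suc n)) w \<odot> h" for h
  proof -
    \<comment> \<open>The factor \<open>Suc n\<close> from the power reduces the factorial and makes
      the cancellation exact.\<close>
    have "inverse (fact (Suc n)) * real (Suc n) = inverse (fact n)"
      by (simp add: field_simps del: of_nat_Suc)
    then have "inverse (fact (Suc n)) *\<^sub>R (?D (Suc n) w \<odot> (- real (Suc n) *\<^sub>R ?P n \<odot> h))
        = - (inverse (fact n) *\<^sub>R (?D (Suc n) w \<odot> (?P n \<odot> h)))"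
      by (simp add: bc_mult.scaleR_left bc_mult.scaleR_right bc_mult.minus_left bc_mult.minus_right
          del: fact_Suc of_nat_Suc)
    then show ?thesis
      by (simp add: bc_remainder_integrand_def bc_mult.scaleR_left scaleR_right_distrib bc_mult_assoc
          bc_mult_commute[of h] del: fact_Suc of_nat_Suc bc_power.simps funpow.simps)
  qed
  ultimately show ?case
    by (simp del: fact_Suc)
qed

section \<open>Line integrals and the remainder formula\<close>

text \<open>The fundamental theorem of calculus for \<open>F \<circ> \<gamma>\<close>, which is
  continuous and, off the finitely many break points, differentiable by the chain rule. The value
  depends on the endpoints only, whence the free choice of the curve.\<close>

lemma has_bc_line_integral_has_derivative:
  assumes "bc_curve_in G \<gamma> r s p0 p"
    and "\<And>w. w \<in> G \<Longrightarrow> (F has_derivative (\<odot>) (f w)) (at w)"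
  shows "has_bc_line_integral f (F p - F p0) \<gamma> r s"
proof -
  have \<gamma>: "r \<le> s" "continuous_on {r..s} \<gamma>" "\<gamma> ` {r..s} \<subseteq> G" "\<gamma> r = p0" "\<gamma> s = p"
    using assms(1) by (auto simp: bc_curve_in_def piecewise_C1_differentiable_on_def)
  obtain S where S: "finite S" "\<gamma> C1_differentiable_on {r..s} - S"
    using assms(1) by (auto simp: bc_curve_in_def piecewise_C1_differentiable_on_def)
  have "((\<lambda>t. f (\<gamma> t) \<odot> vector_derivative \<gamma> (at t within {r..s})) has_integral (F \<circ> \<gamma>) s - (F \<circ> \<gamma>) r) {r..s}"
  proof (rule fundamental_theorem_of_calculus_interior_strong[OF S(1) \<gamma>(1)])
    have "continuous_on G F"
      using assms(2) by (meson continuous_at_imp_continuous_on has_derivative_continuous)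
    then show "continuous_on {r..s} (F \<circ> \<gamma>)"
      using \<gamma> by (meson continuous_on_compose continuous_on_subset)
    fix t assume t: "t \<in> {r<..<s} - S"
    then have "\<gamma> differentiable at t"
      using S(2) by (auto simp: C1_differentiable_on_eq)
    then have 1: "(\<gamma> has_vector_derivative vector_derivative \<gamma> (at t)) (at t)"
      by (simp add: vector_derivative_works)
    \<comment> \<open>At interior points the derivative within the interval is the two-sided
      one.\<close>
    have 2: "vector_derivative \<gamma> (at t within {r..s}) = vector_derivative \<gamma> (at t)"
      using vector_derivative_at_within_ivl[OF 1] t by auto
    have "(F has_derivative (\<odot>) (f (\<gamma> t))) (at (\<gamma> t))"
      by (intro assms(2)) (use \<gamma>(3) t in auto)
    from has_derivative_compose[OF 1[unfolded has_vector_derivative_def] this]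
    show "(F \<circ> \<gamma> has_vector_derivative f (\<gamma> t) \<odot> vector_derivative \<gamma> (at t within {r..s})) (at t)"
      unfolding has_vector_derivative_def 2 by (simp add: o_def bc_mult.scaleR_right)
  qed
  then show ?thesis
    using \<gamma> by (simp add: has_bc_line_integral_def)
qed

text \<open>The Taylor polynomial as a function of its centre is, up to the factor
  \<open>fact m\<close>, an antiderivative of the remainder integrand. The first conclusion ensures
  that the integral in the remainder is a genuine value and not a default.\<close>

lemma bc_taylor_formula:
  assumes "open G" "bc_holomorphic_on \<psi> G" "bc_curve_in G \<gamma> r s p0 p" "n \<ge> 1"
  shows "\<exists>I. has_bc_line_integral (bc_remainder_integrand \<psi> p n) I \<gamma> r s"
    and "\<psi> p = (\<Sum>k<n. bc_taylor_term \<psi> p0 p k) + bc_taylor_remainder \<psi> p \<gamma> r s n"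
proof -
  obtain m where n: "n = Suc m"
    using assms(4) by (cases n) auto
  define F where "F = (\<lambda>q. \<Sum>k<n. bc_taylor_term \<psi> q p k)"
  have "((\<lambda>q. fact m *\<^sub>R F q) has_derivative (\<odot>) (bc_remainder_integrand \<psi> p n w)) (at w)"
    if "w \<in> G" for w
    using has_derivative_scaleR_right[OF bc_taylor_polynomial_has_derivative[OF assms(1,2) that, of p m], of "fact m"]
    by (simp add: F_def n bc_mult.scaleR_left)
  from has_bc_line_integral_has_derivative[OF assms(3) this]
  have I: "has_bc_line_integral (bc_remainder_integrand \<psi> p n) (fact m *\<^sub>R F p - fact m *\<^sub>R F p0) \<gamma> r s" .
  then show "\<exists>I. has_bc_line_integral (bc_remainder_integrand \<psi> p n) I \<gamma> r s"
    by blast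
  \<comment> \<open>With centre \<open>p\<close> only the constant term survives, so the value of
    \<open>F\<close> at the endpoint is \<open>\<psi> p\<close>.\<close>
  have "bc_taylor_term \<psi> p p k = (if k = 0 then \<psi> p else 0)" for k
    by (cases k) (simp_all add: bc_taylor_term_eq bc_mult_commute[of _ "bc_of_real 1"] bc_mult_of_real
        bc_mult.zero_left bc_mult.zero_right)
  then have "F p = \<psi> p"
    by (simp add: F_def n)
  moreover have "bc_line_integral (bc_remainder_integrand \<psi> p n) \<gamma> r s = fact m *\<^sub>R F p - fact m *\<^sub>R F p0"
    using I unfolding has_bc_line_integral_def bc_line_integral_def by (rule integral_unique)
  ultimately have "bc_taylor_remainder \<psi> p \<gamma> r s n = \<psi> p - F p0"
    by (simp add: bc_taylor_remainder_def n bc_divide_of_real bc_mult_of_real bc_mult.scaleR_left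
        scaleR_right_diff_distrib)
  then show "\<psi> p = (\<Sum>k<n. bc_taylor_term \<psi> p0 p k) + bc_taylor_remainder \<psi> p \<gamma> r s n"
    by (simp add: F_def)
qed

section \<open>Convergence of the Taylor series\<close>

text \<open>By compactness an \<open>e\<close>-neighbourhood of the closed ball lies in
  \<open>G\<close>, and it contains the ball of radius \<open>d + e\<close>.\<close>

lemma cball_subset_open_imp_larger_ball:
  fixes a :: "'a :: euclidean_space"
  assumes "open G" "cball a d \<subseteq> G" "d \<ge> 0"
  obtains r where "d < r" "ball a r \<subseteq> G"
proof -
  obtain e where e: "e > 0" "(\<Union>x\<in>cball a d. ball x e) \<subseteq> G"
    using compact_subset_open_imp_ball_epsilon_subset[OF compact_cball assms(1,2)] .
  have "z \<in> G" if z: "dist a z < d + e" for z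
  proof (cases "dist a z \<le> d")
    case True
    then show ?thesis using assms(2) by auto
  next
    case False
    \<comment> \<open>The point at distance \<open>d\<close> from \<open>a\<close> on the segment to
      \<open>z\<close>; its distance from \<open>z\<close> is \<open>dist a z - d\<close>, less than
      \<open>e\<close>.\<close>
    define x where "x = a + (d / dist a z) *\<^sub>R (z - a)"
    have pos: "dist a z > 0" using False assms(3) by linarith
    have "dist a x = d"
      using pos assms(3) by (simp add: x_def dist_norm norm_minus_commute)
    moreover have "dist x z < e"
    proof -
      have "z - x = (1 - d / dist a z) *\<^sub>R (z - a)"
        by (simp add: x_def algebra_simps)
      then have "norm (z - x) = (1 - d / dist a z) * dist a z"
        using False pos by (simp add: dist_norm norm_minus_commute)
      then show ?thesis
        using z pos by (simp add: dist_norm norm_minus_commute field_simps)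
    qed
    ultimately show ?thesis using e(2) by force
  qed
  then show ?thesis
    using that[of "d + e"] e(1) by (auto simp: subset_iff)
qed

text \<open>The slightly larger open ball makes \<open>p\<close> an interior point, so its
  projections lie in the open discs where \<open>f\<close> and \<open>g\<close> equal their power
  series. Convergence is then read off coordinatewise.\<close>

lemma bc_taylor_sums:
  assumes "open G" "bc_holomorphic_on \<psi> G" "cball p0 (norm (p - p0)) \<subseteq> G"
  shows "bc_taylor_term \<psi> p0 p sums \<psi> p"
proof -
  have i: "unit_root \<i>" by simp
  note neg = unit_root_uminus[OF i]
  obtain r where r: "norm (p - p0) < r" "ball p0 r \<subseteq> G"
    using cball_subset_open_imp_larger_ball[OF assms(1,3) norm_ge_zero] by blast
  obtain f g where fg: "f holomorphic_on ball (bc_proj \<i> p0) (sqrt 2 * r)"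
    "g holomorphic_on ball (bc_proj (-\<i>) p0) (sqrt 2 * r)"
    "\<And>k z. z \<in> ball p0 r \<Longrightarrow> bc_proj \<i> (bc_higher_deriv k \<psi> z) = (deriv ^^ k) f (bc_proj \<i> z)"
    "\<And>k z. z \<in> ball p0 r \<Longrightarrow> bc_proj (-\<i>) (bc_higher_deriv k \<psi> z) = (deriv ^^ k) g (bc_proj (-\<i>) z)"
    by (rule bc_holomorphic_split_on_ball[OF i assms(1,2) r(2)]) blast
  have p: "p \<in> ball p0 r" and p0: "p0 \<in> ball p0 r"
    using r(1) by (auto simp: dist_norm norm_minus_commute intro: le_less_trans[OF norm_ge_zero])
  have sums: "(\<lambda>k. bc_proj s (bc_taylor_term \<psi> p0 p k)) sums bc_proj s (\<psi> p)"
    if s: "unit_root s" and h: "h holomorphic_on ball (bc_proj s p0) (sqrt 2 * r)"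
      and eq: "\<And>k z. z \<in> ball p0 r \<Longrightarrow> bc_proj s (bc_higher_deriv k \<psi> z) = (deriv ^^ k) h (bc_proj s z)"
    for s h
    using holomorphic_power_series[OF h bc_proj_mem_ball[OF s p]] eq[OF p, of 0] eq[OF p0]
    by (simp add: bc_taylor_term_eq bc_proj_mult[OF s] bc_proj_power[OF s] scaleR_conv_of_real
        divide_inverse mult_ac)
  show ?thesis
    using sums[OF i fg(1,3)] sums[OF neg fg(2,4)]
    unfolding sums_def tendsto_bc_iff[OF i]
    by (simp add: linear_sum[OF bounded_linear.linear[OF bounded_linear_bc_proj]])
qed

theorem mainTheorem6:
  fixes \<psi> :: "bicomplex \<Rightarrow> bicomplex" and G :: "bicomplex set" and p0 p :: bicomplex
  assumes "open G" and "connected G"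
    and "bc_holomorphic_on \<psi> G"
    and "p0 \<in> G" and "p \<in> G"
  shows "(\<forall>n\<ge>1. \<forall>\<gamma> r s. bc_curve_in G \<gamma> r s p0 p \<longrightarrow>
            (\<exists>I. has_bc_line_integral (bc_remainder_integrand \<psi> p n) I \<gamma> r s) \<and>
            \<psi> p = (\<Sum>k=0..n-1. bc_taylor_term \<psi> p0 p k) + bc_taylor_remainder \<psi> p \<gamma> r s n)
       \<and> ({q. norm (q - p0) \<le> norm (p - p0)} \<subseteq> G \<longrightarrow>
            (\<forall>\<gamma> r s. bc_curve_in G \<gamma> r s p0 p \<longrightarrow>
               (\<lambda>n. norm (bc_taylor_remainder \<psi> p \<gamma> r s n)) \<longlonglongrightarrow> 0) \<and>
            bc_taylor_term \<psi> p0 p sums \<psi> p)"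
proof (intro conjI allI impI)
  fix n :: nat and \<gamma> r s
  assume n: "1 \<le> n" and \<gamma>: "bc_curve_in G \<gamma> r s p0 p"
  note taylor = bc_taylor_formula[OF assms(1,3) \<gamma> n]
  show "\<exists>I. has_bc_line_integral (bc_remainder_integrand \<psi> p n) I \<gamma> r s"
    by (rule taylor(1))
  \<comment> \<open>This uses \<open>n \<ge> 1\<close>: at \<open>n = 0\<close> truncated
    subtraction would leave the index 0 in the first set.\<close>
  have "{0..n - 1} = {..<n}"
    using n by auto
  with taylor(2)
  show "\<psi> p = (\<Sum>k=0..n-1. bc_taylor_term \<psi> p0 p k) + bc_taylor_remainder \<psi> p \<gamma> r s n"
    by simp
next
  assume "{q. norm (q - p0) \<le> norm (p - p0)} \<subseteq> G"
  then have "cball p0 (norm (p - p0)) \<subseteq> G"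
    by (simp add: cball_def dist_norm norm_minus_commute)
  then show sums: "bc_taylor_term \<psi> p0 p sums \<psi> p"
    by (rule bc_taylor_sums[OF assms(1,3)])
  fix \<gamma> r s
  assume \<gamma>: "bc_curve_in G \<gamma> r s p0 p"
  have "(\<lambda>n. \<psi> p - (\<Sum>k<n. bc_taylor_term \<psi> p0 p k)) \<longlonglongrightarrow> \<psi> p - \<psi> p"
    using sums unfolding sums_def by (intro tendsto_intros)
  \<comment> \<open>The remainder formula is available from \<open>n = 1\<close> on, hence the
    equality is stated eventually.\<close>
  moreover have "\<forall>\<^sub>F n in sequentially. \<psi> p - (\<Sum>k<n. bc_taylor_term \<psi> p0 p k) = bc_taylor_remainder \<psi> p \<gamma> r s n"
    using eventually_ge_at_top[of 1]
    by eventually_elim (use bc_taylor_formula(2)[OF assms(1,3) \<gamma>] in \<open>simp add: algebra_simps\<close>)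
  ultimately have "(\<lambda>n. bc_taylor_remainder \<psi> p \<gamma> r s n) \<longlonglongrightarrow> 0"
    by (auto intro: Lim_transform_eventually)
  then show "(\<lambda>n. norm (bc_taylor_remainder \<psi> p \<gamma> r s n)) \<longlonglongrightarrow> 0"
    by (rule tendsto_norm_zero)
qed

end
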